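(* Let $(\Sigma,L,f)$ be initial data for the Prescribed Boundary Problem, and fix a reference trivialization $\phi_0:TL^{\mathbb{C}}\to L\times\mathbb{C}^n$ (not necessarily compatible with the initial data). Let $M:\mathcal{O}p\,\Sigma\to\mathrm{GL}(n,\mathbb{C})$ be the map determined by $df^{\mathbb{C}}$ and $\phi_0$, i.e. $M(p)=df_p^{\mathbb{C}}\circ\phi_{0,p}^{-1}$. Then there exists a trivialization of $TL^{\mathbb{C}}$ compatible with the initial data $(\Sigma,L,f)$ if and only if $M$ can be extended to a map $\widehat M:L\to\mathrm{GL}(n,\mathbb{C})$.
   Context: $\mathbb{R}^{2n}=\mathbb{C}^n$ has the standard symplectic form $\omega=d\lambda$, $\lambda=\frac12\sum_j(x_jdy_j-y_jdx_j)$. Initial data $(\Sigma,L,f)$: $L^n$ is a compact connected oriented manifold with oriented boundary $\Sigma$ such that $TL^{\mathbb{C}}=TL\otimes\mathbb{C}$ is trivial as a complex bundle, and $f:\mathcal{O}p\,\Sigma\to\mathbb{R}^{2n}$ is an exact Lagrangian immersion ($f^*\lambda$ is an exact 1-form) of an open neighbourhood $\mathcal{O}p\,\Sigma$ of $\Sigma$ in $L$. The symbol $\mathcal{O}p\,\Sigma$ denotes an open neighbourhood of $\Sigma$ which may be replaced by a smaller one when needed. The complexification $df^{\mathbb{C}}(v+iw)=df(v)+J\,df(w)$, with $J$ the standard complex structure, is a trivialization of $T(\mathcal{O}p\,\Sigma)^{\mathbb{C}}$. A trivialization $TL^{\mathbb{C}}\to L\times\mathbb{C}^n$ (complex vector bundle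 isomorphism) is compatible with the initial data if it extends this trivialization of $T(\mathcal{O}p\,\Sigma)^{\mathbb{C}}$. Maps and trivializations are smooth. *)

theory Defs
  imports "HOL-Analysis.Analysis"
begin

section \<open>Smooth maps on subsets of normed spaces\<close>

text \<open>\<open>Ck_on k f S\<close> is meant for open \<open>S\<close>: all iterated directional derivatives of \<open>f\<close> up to
  order \<open>k\<close> exist and are continuous.\<close>

primrec Ck_on :: "nat \<Rightarrow> ('a::real_normed_vector \<Rightarrow> 'b::real_normed_vector) \<Rightarrow> 'a set \<Rightarrow> bool"
  where
    "Ck_on 0 f S \<longleftrightarrow> continuous_on S f"
  | "Ck_on (Suc k) f S \<longleftrightarrow>
       (\<forall>x\<in>S. f differentiable (at x)) \<and>
       (\<forall>v. Ck_on k (\<lambda>x. frechet_derivative f (at x) v) S)"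

text \<open>On an arbitrary set (here: relatively open subsets of half-spaces, and their products with
  vector spaces) a map is smooth if near every point of the set it extends to a \<open>C\<^sup>\<infinity>\<close> map on an
  open set of the ambient space.\<close>

definition smooth_on :: "('a::real_normed_vector \<Rightarrow> 'b::real_normed_vector) \<Rightarrow> 'a set \<Rightarrow> bool"
  where "smooth_on f S \<longleftrightarrow>
    (\<forall>x\<in>S. \<exists>W g. open W \<and> x \<in> W \<and> (\<forall>k. Ck_on k g W) \<and> (\<forall>y\<in>S \<inter> W. g y = f y))"

section \<open>Smooth manifolds with boundary\<close>

text \<open>A chart is a pair of its domain and its coordinate map; the values of the coordinate map off
  the domain are irrelevant. The dimension is the size of the index type, so it is at least 1.\<close>

type_synonym ('a, 'n) chart = "'a set \<times> ('a \<Rightarrow> real ^ 'n)"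

abbreviation chart_img :: "('a, 'n) chart \<Rightarrow> (real ^ 'n) set"
  where "chart_img c \<equiv> snd c ` fst c"

abbreviation chart_inv :: "('a, 'n) chart \<Rightarrow> real ^ 'n \<Rightarrow> 'a"
  where "chart_inv c \<equiv> inv_into (fst c) (snd c)"

definition half_space :: "'n \<Rightarrow> (real ^ 'n::finite) set"
  where "half_space k = {x. 0 \<le> x $ k}"

definition is_chart :: "'a topology \<Rightarrow> ('a, 'n::finite) chart \<Rightarrow> bool"
  where "is_chart X c \<longleftrightarrow>
    openin X (fst c) \<and>
    (open (chart_img c) \<or> (\<exists>k. openin (top_of_set (half_space k)) (chart_img c))) \<and>
    homeomorphic_map (subtopology X (fst c)) (top_of_set (chart_img c)) (snd c)"

definition smooth_manifold_with_boundary ::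
    "'a topology \<Rightarrow> ('a, 'n::finite) chart set \<Rightarrow> bool"
  where "smooth_manifold_with_boundary X A \<longleftrightarrow>
    Hausdorff_space X \<and> second_countable X \<and>
    (\<forall>c\<in>A. is_chart X c) \<and> (\<Union>c\<in>A. fst c) = topspace X \<and>
    (\<forall>c\<in>A. \<forall>d\<in>A. smooth_on (snd d \<circ> chart_inv c) (snd c ` (fst c \<inter> fst d)))"

definition manifold_boundary :: "('a, 'n::finite) chart set \<Rightarrow> 'a set"
  where "manifold_boundary A =
    {p. \<exists>c\<in>A. p \<in> fst c \<and>
      (\<exists>k. openin (top_of_set (half_space k)) (chart_img c) \<and> snd c p $ k = 0)}"

definition smooth_on_manifold ::
    "('a, 'n::finite) chart set \<Rightarrow> 'a set \<Rightarrow> ('a \<Rightarrow> 'b::real_normed_vector) \<Rightarrow> bool"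
  where "smooth_on_manifold A U g \<longleftrightarrow>
    (\<forall>c\<in>A. smooth_on (g \<circ> chart_inv c) (snd c ` (fst c \<inter> U)))"

text \<open>Derivative at the point \<open>p\<close> of the change of coordinates from \<open>c\<close> to \<open>d\<close>. Derivatives within
  relatively open subsets of a half-space are unique, also at boundary points.\<close>

definition coord_change ::
    "('a, 'n::finite) chart \<Rightarrow> ('a, 'n) chart \<Rightarrow> 'a \<Rightarrow> real ^ 'n \<Rightarrow> real ^ 'n"
  where "coord_change c d p =
    frechet_derivative (snd d \<circ> chart_inv c) (at (snd c p) within snd c ` (fst c \<inter> fst d))"

text \<open>An orientation is given by recording, for each chart and each point of its domain, whether
  the coordinate frame of the chart is positive (\<open>1\<close>) or negative (\<open>-1\<close>) there. Unlike an oriented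
  half-space atlas, this also works in dimension 1. The orientation of the boundary is the one
  induced by this datum.\<close>

definition is_orientation ::
    "'a topology \<Rightarrow> ('a, 'n::finite) chart set \<Rightarrow> (('a, 'n) chart \<Rightarrow> 'a \<Rightarrow> real) \<Rightarrow> bool"
  where "is_orientation X A ori \<longleftrightarrow>
    (\<forall>c\<in>A. (\<forall>p\<in>fst c. ori c p \<in> {1, -1}) \<and>
           continuous_map (subtopology X (fst c)) euclideanreal (ori c)) \<and>
    (\<forall>c\<in>A. \<forall>d\<in>A. \<forall>p\<in>fst c \<inter> fst d.
       ori c p = sgn (det (matrix (coord_change c d p))) * ori d p)"

section \<open>The tangent bundle and its complexification\<close>

text \<open>A tangent vector at \<open>p\<close> is the family of its coordinate vectors in all charts around \<open>p\<close>
  (and \<open>0\<close> at all other arguments, so that equality of families is equality of vectors).\<close>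

type_synonym ('a, 'n) tvec = "('a, 'n) chart \<Rightarrow> real ^ 'n"

definition tangent_space :: "('a, 'n::finite) chart set \<Rightarrow> 'a \<Rightarrow> ('a, 'n) tvec set"
  where "tangent_space A p =
    {v. (\<forall>c\<in>A. \<forall>d\<in>A. p \<in> fst c \<inter> fst d \<longrightarrow> v d = coord_change c d p (v c)) \<and>
        (\<forall>c. \<not> (c \<in> A \<and> p \<in> fst c) \<longrightarrow> v c = 0)}"

text \<open>The tangent vector at \<open>p\<close> with coordinate vector \<open>u\<close> in the chart \<open>c\<close>.\<close>

definition chart_tvec ::
    "('a, 'n::finite) chart set \<Rightarrow> ('a, 'n) chart \<Rightarrow> 'a \<Rightarrow> real ^ 'n \<Rightarrow> ('a, 'n) tvec"
  where "chart_tvec A c p u =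
    (\<lambda>d. if d \<in> A \<and> p \<in> fst d then coord_change c d p u else 0)"

text \<open>The differential of \<open>g\<close> at \<open>p\<close>, computed in some chart of the atlas around \<open>p\<close>; by the chain
  rule, the value on a tangent vector does not depend on the chart.\<close>

definition differential ::
    "('a, 'n::finite) chart set \<Rightarrow> ('a \<Rightarrow> 'b::real_normed_vector) \<Rightarrow> 'a \<Rightarrow> ('a, 'n) tvec \<Rightarrow> 'b"
  where "differential A g p v =
    (let c = (SOME c. c \<in> A \<and> p \<in> fst c)
     in frechet_derivative (g \<circ> chart_inv c) (at (snd c p) within chart_img c) (v c))"

text \<open>The pair \<open>(v, w)\<close> stands for the element \<open>v + \<i> w\<close> of the complexified tangent space.\<close>

type_synonym ('a, 'n) ctvec = "('a, 'n) tvec \<times> ('a, 'n) tvec"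

definition ctangent_space :: "('a, 'n::finite) chart set \<Rightarrow> 'a \<Rightarrow> ('a, 'n) ctvec set"
  where "ctangent_space A p = tangent_space A p \<times> tangent_space A p"

definition ct_add :: "('a, 'n::finite) ctvec \<Rightarrow> ('a, 'n) ctvec \<Rightarrow> ('a, 'n) ctvec"
  where "ct_add V W = ((\<lambda>c. fst V c + fst W c), (\<lambda>c. snd V c + snd W c))"

definition ct_scale :: "complex \<Rightarrow> ('a, 'n::finite) ctvec \<Rightarrow> ('a, 'n) ctvec"
  where "ct_scale z V =
    ((\<lambda>c. Re z *\<^sub>R fst V c - Im z *\<^sub>R snd V c), (\<lambda>c. Re z *\<^sub>R snd V c + Im z *\<^sub>R fst V c))"

text \<open>Trivializations of the complexified tangent bundle over the whole manifold: fibrewise complex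
  linear isomorphisms onto \<open>\<complex>\<^sup>n\<close> which, together with their inverses, are smooth as maps between the
  total spaces. The last two conditions express this smoothness in the bundle charts induced by the
  charts of the manifold.\<close>

definition trivialization ::
    "'a topology \<Rightarrow> ('a, 'n::finite) chart set \<Rightarrow> ('a \<Rightarrow> ('a, 'n) ctvec \<Rightarrow> complex ^ 'n) \<Rightarrow> bool"
  where "trivialization X A \<phi> \<longleftrightarrow>
    (\<forall>p\<in>topspace X.
       bij_betw (\<phi> p) (ctangent_space A p) UNIV \<and>
       (\<forall>V\<in>ctangent_space A p. \<forall>W\<in>ctangent_space A p. \<phi> p (ct_add V W) = \<phi> p V + \<phi> p W) \<and>
       (\<forall>z. \<forall>V\<in>ctangent_space A p. \<phi> p (ct_scale z V) = z *s \<phi> p V)) \<and>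
    (\<forall>c\<in>A.
       smooth_on
         (\<lambda>(x, u, w). let p = chart_inv c x in \<phi> p (chart_tvec A c p u, chart_tvec A c p w))
         (chart_img c \<times> UNIV \<times> UNIV)) \<and>
    (\<forall>c\<in>A.
       smooth_on
         (\<lambda>(x, z). let p = chart_inv c x; V = inv_into (ctangent_space A p) (\<phi> p) z
                   in (fst V c, snd V c))
         (chart_img c \<times> UNIV))"

section \<open>Exact Lagrangian immersions into \<open>\<complex>\<^sup>n\<close>\<close>

text \<open>The 1-form \<open>\<lambda> = 1/2 \<Sum>\<^sub>j (x\<^sub>j dy\<^sub>j - y\<^sub>j dx\<^sub>j)\<close> at the point \<open>z = x + \<i> y\<close>, applied to \<open>w\<close>.\<close>

definition liouville :: "complex ^ 'n::finite \<Rightarrow> complex ^ 'n \<Rightarrow> real"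
  where "liouville z w =
    (1 / 2) * (\<Sum>j\<in>UNIV. Re (z $ j) * Im (w $ j) - Im (z $ j) * Re (w $ j))"

definition omega :: "complex ^ 'n::finite \<Rightarrow> complex ^ 'n \<Rightarrow> real"
  where "omega u v = (\<Sum>j\<in>UNIV. Re (u $ j) * Im (v $ j) - Im (u $ j) * Re (v $ j))"

lemma liouville_has_derivative:
  "((\<lambda>z. liouville z v) has_derivative (\<lambda>u. liouville u v)) (at z)"
proof -
  have "linear (\<lambda>z. liouville z v)"
    by (rule linearI)
      (auto simp: liouville_def algebra_simps sum.distrib sum_distrib_left sum_subtractf)
  then show ?thesis
    by (simp add: linear_imp_has_derivative)
qed

lemma omega_eq_d_liouville:
  "omega u v =
    frechet_derivative (\<lambda>z. liouville z v) (at z) u - frechet_derivative (\<lambda>z. liouville z u) (at z) v"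
proof -
  have "liouville u v = omega u v / 2" "liouville v u = - liouville u v"
    by (simp_all add: omega_def liouville_def sum_negf[symmetric] algebra_simps)
  then show ?thesis
    by (simp add: frechet_derivative_at[OF liouville_has_derivative, symmetric])
qed

definition exact_lagrangian_immersion ::
    "('a, 'n::finite) chart set \<Rightarrow> 'a set \<Rightarrow> ('a \<Rightarrow> complex ^ 'n) \<Rightarrow> bool"
  where "exact_lagrangian_immersion A U f \<longleftrightarrow>
    smooth_on_manifold A U f \<and>
    (\<forall>p\<in>U. inj_on (differential A f p) (tangent_space A p)) \<and>
    (\<forall>p\<in>U. \<forall>v\<in>tangent_space A p. \<forall>w\<in>tangent_space A p.
       omega (differential A f p v) (differential A f p w) = 0) \<and>
    (\<exists>h :: 'a \<Rightarrow> real. smooth_on_manifold A U h \<and>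
       (\<forall>p\<in>U. \<forall>v\<in>tangent_space A p.
          liouville (f p) (differential A f p v) = differential A h p v))"

section \<open>The Prescribed Boundary Problem\<close>

text \<open>\<open>X\<close>, \<open>A\<close> and \<open>ori\<close> are the topology, the atlas and the orientation of the manifold \<open>L\<close>, \<open>S\<close> is
  its boundary \<open>\<Sigma>\<close>, and \<open>U\<close> is the neighbourhood of \<open>\<Sigma>\<close> on which \<open>f\<close> is given.\<close>

definition initial_data ::
    "'a topology \<Rightarrow> ('a, 'n::finite) chart set \<Rightarrow> (('a, 'n) chart \<Rightarrow> 'a \<Rightarrow> real) \<Rightarrow> 'a set \<Rightarrow>
      'a set \<Rightarrow> ('a \<Rightarrow> complex ^ 'n) \<Rightarrow> bool"
  where "initial_data X A ori S U f \<longleftrightarrow>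
    smooth_manifold_with_boundary X A \<and> compact_space X \<and> connected_space X \<and>
    is_orientation X A ori \<and>
    S = manifold_boundary A \<and>
    (\<exists>\<phi>. trivialization X A \<phi>) \<and>
    openin X U \<and> S \<subseteq> U \<and>
    exact_lagrangian_immersion A U f"

text \<open>\<open>df\<^sup>\<complex>(v + \<i> w) = df(v) + J df(w)\<close>, where \<open>J\<close> is multiplication by \<open>\<i>\<close> on \<open>\<complex>\<^sup>n\<close>.\<close>

definition cdifferential ::
    "('a, 'n::finite) chart set \<Rightarrow> ('a \<Rightarrow> complex ^ 'n) \<Rightarrow> 'a \<Rightarrow> ('a, 'n) ctvec \<Rightarrow> complex ^ 'n"
  where "cdifferential A f p V = differential A f p (fst V) + \<i> *s differential A f p (snd V)"

text \<open>As usual for \<open>\<O>p \<Sigma>\<close>, extending data given near \<open>\<Sigma>\<close> means agreeing with it on some, possibly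
  smaller, open neighbourhood \<open>V\<close> of \<open>\<Sigma>\<close>.\<close>

definition compatible ::
    "'a topology \<Rightarrow> ('a, 'n::finite) chart set \<Rightarrow> 'a set \<Rightarrow> 'a set \<Rightarrow> ('a \<Rightarrow> complex ^ 'n) \<Rightarrow>
      ('a \<Rightarrow> ('a, 'n) ctvec \<Rightarrow> complex ^ 'n) \<Rightarrow> bool"
  where "compatible X A S U f \<phi> \<longleftrightarrow>
    (\<exists>V. openin X V \<and> S \<subseteq> V \<and> V \<subseteq> U \<and>
       (\<forall>p\<in>V. \<forall>v\<in>ctangent_space A p. \<phi> p v = cdifferential A f p v))"

definition comparison_map ::
    "('a, 'n::finite) chart set \<Rightarrow> ('a \<Rightarrow> complex ^ 'n) \<Rightarrow>
      ('a \<Rightarrow> ('a, 'n) ctvec \<Rightarrow> complex ^ 'n) \<Rightarrow> 'a \<Rightarrow> complex ^ 'n ^ 'n"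
  where "comparison_map A f \<phi>\<^sub>0 p =
    matrix (\<lambda>z. cdifferential A f p (inv_into (ctangent_space A p) (\<phi>\<^sub>0 p) z))"

definition extends_to_GL ::
    "'a topology \<Rightarrow> ('a, 'n::finite) chart set \<Rightarrow> 'a set \<Rightarrow> 'a set \<Rightarrow> ('a \<Rightarrow> complex ^ 'n ^ 'n) \<Rightarrow> bool"
  where "extends_to_GL X A S U M \<longleftrightarrow>
    (\<exists>Mhat. smooth_on_manifold A (topspace X) Mhat \<and>
       (\<forall>p\<in>topspace X. invertible (Mhat p)) \<and>
       (\<exists>V. openin X V \<and> S \<subseteq> V \<and> V \<subseteq> U \<and> (\<forall>p\<in>V. Mhat p = M p)))"

end

theory Submission
  imports Defs
begin

text \<open>Two trivializations differ by a unique smooth map into the general linear group: from \<open>\<phi>\<close>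
  one obtains \<open>p \<mapsto> \<phi>\<^sub>p \<circ> \<phi>\<^sub>0\<^sub>,\<^sub>p\<^sup>-\<^sup>1\<close>, and from \<open>Mhat\<close> one obtains \<open>p \<mapsto> Mhat p \<circ> \<phi>\<^sub>0\<^sub>,\<^sub>p\<close>. Under this
  correspondence agreement of \<open>\<phi>\<close> with \<open>df\<^sup>\<complex>\<close> near the boundary becomes agreement of \<open>Mhat\<close> with
  \<open>M\<close>. Smoothness of the inverse of the new trivialization follows from Cramer's rule.\<close>

section \<open>Calculus of smooth maps\<close>

lemma Ck_on_subset: "Ck_on k f S \<Longrightarrow> T \<subseteq> S \<Longrightarrow> Ck_on k f T"
  by (induction k arbitrary: f) (auto intro: continuous_on_subset)

text \<open>Derivatives in \<open>Ck_on\<close> are taken in the ambient space, so openness of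
  \<open>S\<close> is what makes them depend only on the values on \<open>S\<close>.\<close>

lemma Ck_on_cong:
  assumes "open S" "\<And>x. x \<in> S \<Longrightarrow> f x = g x" "Ck_on k f S"
  shows "Ck_on k g S"
  using assms(2,3)
proof (induction k arbitrary: f g)
  case 0
  then show ?case using continuous_on_cong by force
next
  case (Suc k)
  have der: "(g has_derivative frechet_derivative f (at x)) (at x)" if "x \<in> S" for x
    using Suc.prems that \<open>open S\<close> frechet_derivative_works
    by (metis Ck_on.simps(2) has_derivative_transform_within_open)
  have "frechet_derivative f (at x) v = frechet_derivative g (at x) v" if "x \<in> S" for x v
    using frechet_derivative_at[OF der[OF that]] by simp
  then have "Ck_on k (\<lambda>x. frechet_derivative g (at x) v) S" for v
    using Suc.IH[of "\<lambda>x. frechet_derivative f (at x) v"] Suc.prems(2) by simp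
  then show ?case using der by (auto simp: differentiable_def)
qed

text \<open>Replaces the choice operator \<open>frechet_derivative\<close> by an explicit formula
  for the derivative. The closure rules below then follow by induction on \<open>k\<close> from the
  matching differentiation rule.\<close>

lemma Ck_on_SucI:
  assumes "open S" "\<And>x. x \<in> S \<Longrightarrow> (f has_derivative f' x) (at x)"
    and "\<And>v. Ck_on k (\<lambda>x. f' x v) S"
  shows "Ck_on (Suc k) f S"
proof -
  have "f' x v = frechet_derivative f (at x) v" if "x \<in> S" for x v
    using frechet_derivative_at[OF assms(2)[OF that]] by simp
  then have "Ck_on k (\<lambda>x. frechet_derivative f (at x) v) S" for v
    using Ck_on_cong[OF assms(1) _ assms(3)[of v]] by simp
  then show ?thesis using assms(2) by (auto simp: differentiable_def)
qed

lemma Ck_on_SucD: "Ck_on (Suc k) f S \<Longrightarrow> Ck_on k f S"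
proof (induction k arbitrary: f)
  case 0
  then show ?case
    by (auto intro!: continuous_at_imp_continuous_on differentiable_imp_continuous_within)
next
  case (Suc k)
  then show ?case by (metis Ck_on.simps(2))
qed

lemma Ck_on_has_derivative:
  "Ck_on (Suc k) f S \<Longrightarrow> x \<in> S \<Longrightarrow> (f has_derivative frechet_derivative f (at x)) (at x)"
  using frechet_derivative_works by auto

lemma Ck_on_const: "open S \<Longrightarrow> Ck_on k (\<lambda>x. c) S"
proof (induction k arbitrary: c)
  case (Suc k)
  then show ?case by (intro Ck_on_SucI[where f' = "\<lambda>x v. 0"]) auto
qed simp

lemma Ck_on_add:
  "open S \<Longrightarrow> Ck_on k f S \<Longrightarrow> Ck_on k g S \<Longrightarrow> Ck_on k (\<lambda>x. f x + g x) S"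
proof (induction k arbitrary: f g)
  case 0
  then show ?case by (auto intro: continuous_on_add)
next
  case (Suc k)
  show ?case
    by (rule Ck_on_SucI[OF Suc.prems(1) has_derivative_add[OF
            Ck_on_has_derivative[OF Suc.prems(2)] Ck_on_has_derivative[OF Suc.prems(3)]]])
      (use Suc in auto)
qed

lemma Ck_on_sum:
  "open S \<Longrightarrow> (\<And>i. i \<in> I \<Longrightarrow> Ck_on k (f i) S) \<Longrightarrow> Ck_on k (\<lambda>x. \<Sum>i\<in>I. f i x) S"
  by (induction I rule: infinite_finite_induct) (auto simp: Ck_on_const Ck_on_add)

lemma Ck_on_bounded_linear:
  "open S \<Longrightarrow> bounded_linear L \<Longrightarrow> Ck_on k f S \<Longrightarrow> Ck_on k (\<lambda>x. L (f x)) S"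
proof (induction k arbitrary: f)
  case 0
  then show ?case by (auto intro: bounded_linear.continuous_on)
next
  case (Suc k)
  show ?case
    by (rule Ck_on_SucI[OF Suc.prems(1) bounded_linear.has_derivative[OF Suc.prems(2)
            Ck_on_has_derivative[OF Suc.prems(3)]]])
      (use Suc in auto)
qed

text \<open>The product rule mixes a derivative of one factor with the other factor itself. The
  induction therefore varies both \<open>f\<close> and \<open>g\<close>, and
  \<open>Ck_on_SucD\<close> lowers the order of the undifferentiated factor.\<close>

lemma Ck_on_bilinear:
  assumes "open S" "bounded_bilinear h"
  shows "Ck_on k f S \<Longrightarrow> Ck_on k g S \<Longrightarrow> Ck_on k (\<lambda>x. h (f x) (g x)) S"
proof (induction k arbitrary: f g)
  case 0
  then show ?case using assms by (auto intro: bounded_bilinear.continuous_on)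
next
  case (Suc k)
  show ?case
  proof (rule Ck_on_SucI[OF assms(1) bounded_bilinear.FDERIV[OF assms(2)
            Ck_on_has_derivative[OF Suc.prems(1)] Ck_on_has_derivative[OF Suc.prems(2)]]])
    fix v
    show "Ck_on k (\<lambda>x. h (f x) (frechet_derivative g (at x) v) +
        h (frechet_derivative f (at x) v) (g x)) S"
      using Suc.prems Ck_on_SucD[OF Suc.prems(1)] Ck_on_SucD[OF Suc.prems(2)]
      by (intro Ck_on_add Suc.IH assms(1)) auto
  qed
qed

text \<open>The derivative of the inverse is a product of inverses and the derivative of
  \<open>f\<close>, so order \<open>k\<close> of the inverse yields order
  \<open>Suc k\<close>.\<close>

lemma Ck_on_inverse:
  fixes f :: "'a::real_normed_vector \<Rightarrow> 'b::real_normed_div_algebra"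
  assumes "open S" "\<And>x. x \<in> S \<Longrightarrow> f x \<noteq> 0"
  shows "Ck_on k f S \<Longrightarrow> Ck_on k (\<lambda>x. inverse (f x)) S"
proof (induction k)
  case 0
  then show ?case using assms by (auto intro: continuous_on_inverse)
next
  case (Suc k)
  have IH: "Ck_on k (\<lambda>x. inverse (f x)) S" using Suc Ck_on_SucD by blast
  show ?case
  proof (rule Ck_on_SucI[OF assms(1)])
    fix x assume "x \<in> S"
    then show "((\<lambda>x. inverse (f x)) has_derivative
        (\<lambda>v. - (inverse (f x) * frechet_derivative f (at x) v * inverse (f x)))) (at x)"
      using assms(2) Ck_on_has_derivative[OF Suc.prems] by (intro Deriv.has_derivative_inverse) auto
  next
    fix v
    show "Ck_on k (\<lambda>x. - (inverse (f x) * frechet_derivative f (at x) v * inverse (f x))) S"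
      using Suc.prems IH
      by (intro Ck_on_bounded_linear[OF assms(1) bounded_linear_minus[OF bounded_linear_ident]]
          Ck_on_bilinear[OF assms(1) bounded_bilinear_mult]) auto
  qed
qed

text \<open>In the chain rule both the base point and the direction of the derivative of
  \<open>g\<close> vary with \<open>x\<close>, whereas \<open>Ck_on\<close> controls fixed
  directions only. Expanding the direction in \<open>Basis\<close> reduces to fixed ones; this is
  where the intermediate space has to be Euclidean.\<close>

lemma Ck_on_compose:
  fixes f :: "'a::real_normed_vector \<Rightarrow> 'b::euclidean_space"
  assumes "open S" "open T" "f ` S \<subseteq> T"
  shows "Ck_on k f S \<Longrightarrow> Ck_on k g T \<Longrightarrow> Ck_on k (\<lambda>x. g (f x)) S"
proof (induction k arbitrary: g)
  case 0
  then show ?case using assms by (auto intro: continuous_on_compose2)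
next
  case (Suc k)
  show ?case
  proof (rule Ck_on_SucI[OF assms(1)])
    fix x assume x: "x \<in> S"
    let ?D = "frechet_derivative g (at (f x))" and ?d = "frechet_derivative f (at x)"
    have g: "(g has_derivative ?D) (at (f x))"
      using Ck_on_has_derivative[OF Suc.prems(2)] assms(3) x by auto
    have "?D (?d v) = (\<Sum>b\<in>Basis. (?d v \<bullet> b) *\<^sub>R ?D b)" for v
    proof -
      have "?D (?d v) = ?D (\<Sum>b\<in>Basis. (?d v \<bullet> b) *\<^sub>R b)" by (simp add: euclidean_representation)
      also have "\<dots> = (\<Sum>b\<in>Basis. (?d v \<bullet> b) *\<^sub>R ?D b)"
        using has_derivative_linear[OF g] by (simp add: linear_sum linear_scale)
      finally show ?thesis .
    qed
    then show "((\<lambda>x. g (f x)) has_derivative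
        (\<lambda>v. \<Sum>b\<in>Basis. (?d v \<bullet> b) *\<^sub>R ?D b)) (at x)"
      using has_derivative_compose[OF Ck_on_has_derivative[OF Suc.prems(1) x] g] by simp
  next
    fix v
    have "Ck_on k (\<lambda>x. frechet_derivative g (at (f x)) b) S" for b
      using Suc.IH[of "\<lambda>y. frechet_derivative g (at y) b"] Suc.prems Ck_on_SucD by auto
    then show "Ck_on k (\<lambda>x. \<Sum>b\<in>Basis. (frechet_derivative f (at x) v \<bullet> b) *\<^sub>R
        frechet_derivative g (at (f x)) b) S"
      using Suc.prems
      by (intro Ck_on_sum Ck_on_bilinear[OF assms(1) bounded_bilinear_scaleR] assms(1)
          Ck_on_bounded_linear[OF assms(1) bounded_linear_inner_left]) auto
  qed
qed

section \<open>Smooth maps on arbitrary sets, by way of local extensions\<close>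

lemma smooth_onI:
  assumes "\<And>x. x \<in> S \<Longrightarrow> \<exists>W g. open W \<and> x \<in> W \<and> (\<forall>k. Ck_on k g W) \<and> (\<forall>y\<in>S \<inter> W. g y = f y)"
  shows "smooth_on f S"
  using assms unfolding smooth_on_def by blast

lemma smooth_on_cong: "smooth_on f S \<Longrightarrow> (\<And>x. x \<in> S \<Longrightarrow> f x = g x) \<Longrightarrow> smooth_on g S"
  unfolding smooth_on_def by (auto simp: Ball_def)

lemma smooth_on_const: "smooth_on (\<lambda>x. c) S"
  by (rule smooth_onI) (use Ck_on_const open_UNIV in blast)

lemma smooth_on_bounded_linear:
  assumes "bounded_linear L" "smooth_on f S"
  shows "smooth_on (\<lambda>x. L (f x)) S"
proof (rule smooth_onI)
  fix x assume x: "x \<in> S"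
  obtain W g where "open W" "x \<in> W" "\<And>k. Ck_on k g W"
    "\<And>y. y \<in> S \<Longrightarrow> y \<in> W \<Longrightarrow> g y = f y"
    using assms(2) x unfolding smooth_on_def by (metis IntI)
  then show "\<exists>W g. open W \<and> x \<in> W \<and> (\<forall>k. Ck_on k g W) \<and> (\<forall>y\<in>S \<inter> W. g y = L (f y))"
    using assms(1) by (intro exI[of _ W] exI[of _ "\<lambda>x. L (g x)"]) (auto intro: Ck_on_bounded_linear)
qed

lemma smooth_on_ident: "smooth_on (\<lambda>x. x) S"
proof (rule smooth_onI)
  fix x :: 'a
  have "Ck_on k (\<lambda>x::'a. x) UNIV" for k
    by (cases k)
      (auto simp: Ck_on_const intro!: Ck_on_SucI[where f' = "\<lambda>x v. v"] simp del: Ck_on.simps(2))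
  then show "\<exists>W g. open W \<and> x \<in> W \<and> (\<forall>k. Ck_on k g W) \<and> (\<forall>y\<in>S \<inter> W. g y = y)"
    by (intro exI[of _ UNIV] exI[of _ "\<lambda>x. x"]) auto
qed

lemma smooth_on_linear: "bounded_linear L \<Longrightarrow> smooth_on L S"
  using smooth_on_bounded_linear[OF _ smooth_on_ident, of L S] by simp

text \<open>Local extensions of \<open>f\<close> and \<open>g\<close> are combined on the
  intersection of their domains.\<close>

lemma smooth_on_bilinear:
  assumes "bounded_bilinear h" "smooth_on f S" "smooth_on g S"
  shows "smooth_on (\<lambda>x. h (f x) (g x)) S"
proof (rule smooth_onI)
  fix x assume x: "x \<in> S"
  obtain V F where F: "open V" "x \<in> V" "\<And>k. Ck_on k F V"
    "\<And>y. y \<in> S \<Longrightarrow> y \<in> V \<Longrightarrow> F y = f y" using assms(2) x unfolding smooth_on_def by (metis IntI)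
  obtain W G where G: "open W" "x \<in> W" "\<And>k. Ck_on k G W"
    "\<And>y. y \<in> S \<Longrightarrow> y \<in> W \<Longrightarrow> G y = g y" using assms(3) x unfolding smooth_on_def by (metis IntI)
  have "Ck_on k (\<lambda>x. h (F x) (G x)) (V \<inter> W)" for k
    using F(1) G(1)
    by (auto intro!: Ck_on_bilinear[OF _ assms(1) Ck_on_subset[OF F(3)] Ck_on_subset[OF G(3)]])
  then show "\<exists>W g'. open W \<and> x \<in> W \<and> (\<forall>k. Ck_on k g' W) \<and> (\<forall>y\<in>S \<inter> W. g' y = h (f y) (g y))"
    using F G by (intro exI[of _ "V \<inter> W"] exI[of _ "\<lambda>x. h (F x) (G x)"]) auto
qed

lemma smooth_on_add:
  assumes "smooth_on f S" "smooth_on g S"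
  shows "smooth_on (\<lambda>x. f x + g x) S"
proof (rule smooth_onI)
  fix x assume x: "x \<in> S"
  obtain V F where F: "open V" "x \<in> V" "\<And>k. Ck_on k F V"
    "\<And>y. y \<in> S \<Longrightarrow> y \<in> V \<Longrightarrow> F y = f y" using assms(1) x unfolding smooth_on_def by (metis IntI)
  obtain W G where G: "open W" "x \<in> W" "\<And>k. Ck_on k G W"
    "\<And>y. y \<in> S \<Longrightarrow> y \<in> W \<Longrightarrow> G y = g y" using assms(2) x unfolding smooth_on_def by (metis IntI)
  have "Ck_on k (\<lambda>x. F x + G x) (V \<inter> W)" for k
    using F(1) G(1) by (auto intro!: Ck_on_add[OF _ Ck_on_subset[OF F(3)] Ck_on_subset[OF G(3)]])
  then show "\<exists>W g'. open W \<and> x \<in> W \<and> (\<forall>k. Ck_on k g' W) \<and> (\<forall>y\<in>S \<inter> W. g' y = f y + g y)"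
    using F G by (intro exI[of _ "V \<inter> W"] exI[of _ "\<lambda>x. F x + G x"]) auto
qed

lemma smooth_on_sum:
  "(\<And>i. i \<in> I \<Longrightarrow> smooth_on (f i) S) \<Longrightarrow> smooth_on (\<lambda>x. \<Sum>i\<in>I. f i x) S"
  by (induction I rule: infinite_finite_induct) (auto simp: smooth_on_const smooth_on_add)

lemma smooth_on_mult:
  fixes f g :: "'a::real_normed_vector \<Rightarrow> 'b::real_normed_algebra"
  shows "smooth_on f S \<Longrightarrow> smooth_on g S \<Longrightarrow> smooth_on (\<lambda>x. f x * g x) S"
  by (rule smooth_on_bilinear[OF bounded_bilinear_mult])

lemma smooth_on_prod:
  fixes f :: "'i \<Rightarrow> 'a::real_normed_vector \<Rightarrow> 'b::{real_normed_algebra, comm_ring_1}"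
  shows "(\<And>i. i \<in> I \<Longrightarrow> smooth_on (f i) S) \<Longrightarrow> smooth_on (\<lambda>x. \<Prod>i\<in>I. f i x) S"
  by (induction I rule: infinite_finite_induct) (auto simp: smooth_on_const smooth_on_mult)

lemma smooth_on_inverse:
  fixes f :: "'a::real_normed_vector \<Rightarrow> 'b::real_normed_div_algebra"
  assumes "smooth_on f S" "\<And>x. x \<in> S \<Longrightarrow> f x \<noteq> 0"
  shows "smooth_on (\<lambda>x. inverse (f x)) S"
proof (rule smooth_onI)
  fix x assume x: "x \<in> S"
  obtain V F where F: "open V" "x \<in> V" "\<And>k. Ck_on k F V"
    "\<And>y. y \<in> S \<Longrightarrow> y \<in> V \<Longrightarrow> F y = f y" using assms(1) x unfolding smooth_on_def by (metis IntI)
  \<comment> \<open>The extension \<open>F\<close> may vanish at points off \<open>S\<close>. Its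
    continuity, which is order 0, makes the set where it is nonzero open.\<close>
  define W where "W = V \<inter> F -` (- {0})"
  have W: "open W" unfolding W_def
    using F(1) F(3)[of 0] by (intro continuous_open_preimage) auto
  have "Ck_on k (\<lambda>x. inverse (F x)) W" for k
    using W by (rule Ck_on_inverse[OF _ _ Ck_on_subset[OF F(3)]]) (auto simp: W_def)
  then show "\<exists>W g. open W \<and> x \<in> W \<and> (\<forall>k. Ck_on k g W) \<and> (\<forall>y\<in>S \<inter> W. g y = inverse (f y))"
    using W F x assms(2) by (intro exI[of _ W] exI[of _ "\<lambda>x. inverse (F x)"]) (auto simp: W_def)
qed

lemma smooth_on_compose:
  fixes f :: "'a::real_normed_vector \<Rightarrow> 'b::euclidean_space"
  assumes "smooth_on g T" "smooth_on f S" "\<And>x. x \<in> S \<Longrightarrow> f x \<in> T"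
  shows "smooth_on (\<lambda>x. g (f x)) S"
proof (rule smooth_onI)
  fix x assume x: "x \<in> S"
  obtain V F where F: "open V" "x \<in> V" "\<And>k. Ck_on k F V"
    "\<And>y. y \<in> S \<Longrightarrow> y \<in> V \<Longrightarrow> F y = f y" using assms(2) x unfolding smooth_on_def by (metis IntI)
  obtain W G where G: "open W" "f x \<in> W" "\<And>k. Ck_on k G W"
    "\<And>y. y \<in> T \<Longrightarrow> y \<in> W \<Longrightarrow> G y = g y" using assms(1) assms(3)[OF x] unfolding smooth_on_def by (metis IntI)
  \<comment> \<open>Off \<open>S\<close> the extension \<open>F\<close> need not take values where
    \<open>G\<close> is controlled, so its domain shrinks to a preimage.\<close>
  define V' where "V' = V \<inter> F -` W"
  have V': "open V'" unfolding V'_def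
    using F(1) F(3)[of 0] G(1) by (intro continuous_open_preimage) auto
  have "Ck_on k (\<lambda>x. G (F x)) V'" for k
    using V' G(1) by (rule Ck_on_compose[OF _ _ _ Ck_on_subset[OF F(3)] G(3)]) (auto simp: V'_def)
  then show "\<exists>W g'. open W \<and> x \<in> W \<and> (\<forall>k. Ck_on k g' W) \<and> (\<forall>y\<in>S \<inter> W. g' y = g (f y))"
    using V' F G x assms(3) by (intro exI[of _ V'] exI[of _ "\<lambda>x. G (F x)"]) (auto simp: V'_def)
qed

lemma smooth_on_Pair:
  assumes "smooth_on f S" "smooth_on g S"
  shows "smooth_on (\<lambda>x. (f x, g x)) S"
proof -
  have "smooth_on (\<lambda>x. (f x, 0) + (0, g x)) S"
    using assms
    by (intro smooth_on_add smooth_on_bounded_linear[of "\<lambda>y. (y, 0)"]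
        smooth_on_bounded_linear[of "\<lambda>y. (0, y)"])
      (auto intro: bounded_linear_Pair bounded_linear_ident bounded_linear_zero)
  then show ?thesis by simp
qed

section \<open>Smooth vectors and matrices, and Cramer's rule\<close>

lemma smooth_on_vec_nth:
  "smooth_on f S \<Longrightarrow> smooth_on (\<lambda>x. f x $ i) S"
  by (rule smooth_on_bounded_linear[OF bounded_linear_vec_nth])

lemma smooth_on_vecI:
  fixes f :: "'a::real_normed_vector \<Rightarrow> 'b::euclidean_space ^ 'n"
  assumes "\<And>i. smooth_on (\<lambda>x. f x $ i) S"
  shows "smooth_on f S"
proof -
  have axis: "bounded_linear (axis i :: 'b \<Rightarrow> 'b ^ 'n)" for i
    unfolding linear_conv_bounded_linear[symmetric]
    by (rule linearI) (auto simp: axis_def vec_eq_iff)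
  have "smooth_on (\<lambda>x. \<Sum>i\<in>UNIV. axis i (f x $ i)) S"
    by (intro smooth_on_sum smooth_on_bounded_linear[OF axis] assms)
  moreover have "(\<Sum>i\<in>UNIV. axis i (f x $ i)) = f x" for x
    by (simp add: vec_eq_iff axis_def)
  ultimately show ?thesis by simp
qed

lemma smooth_on_matrix_vector_mult:
  fixes F :: "'a::real_normed_vector \<Rightarrow> complex ^ 'n ^ 'm"
  assumes "smooth_on F S" "smooth_on g S"
  shows "smooth_on (\<lambda>x. F x *v g x) S"
  unfolding matrix_vector_mult_def
  by (rule smooth_on_vecI) (auto intro!: smooth_on_sum smooth_on_mult smooth_on_vec_nth assms)

text \<open>The Leibniz formula is a polynomial in the entries. The hypothesis is stated by entries
  to suit the matrices with a replaced column in Cramer's rule.\<close>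

lemma smooth_on_det:
  fixes F :: "'a::real_normed_vector \<Rightarrow> complex ^ 'n ^ 'n"
  assumes "\<And>i j. smooth_on (\<lambda>x. F x $ i $ j) S"
  shows "smooth_on (\<lambda>x. det (F x)) S"
  unfolding det_def
  by (intro smooth_on_sum smooth_on_mult smooth_on_const smooth_on_prod assms)

lemma matrix_mult_matrix_inv:
  fixes M :: "'a::semiring_1 ^ 'n ^ 'm"
  assumes "invertible M"
  shows "M ** matrix_inv M = mat 1" "matrix_inv M ** M = mat 1"
  using someI_ex[OF assms[unfolded invertible_def]] by (simp_all add: matrix_inv_def)

text \<open>\<open>matrix_inv\<close> is defined by choice and shows no dependence on the entries.
  Cramer's rule, applied to the system solved by \<open>matrix_inv M *v z\<close>, provides a
  formula whose smoothness is visible.\<close>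

lemma matrix_inv_mult_vec_cramer:
  fixes M :: "'a::field ^ 'n ^ 'n"
  assumes "invertible M"
  shows "matrix_inv M *v z = (\<chi> k. det (\<chi> i j. if j = k then z $ i else M $ i $ j) * inverse (det M))"
proof -
  have "det M \<noteq> 0" using assms by (simp add: invertible_det_nz)
  moreover have "M *v (matrix_inv M *v z) = z"
    by (simp add: assms matrix_vector_mul_assoc matrix_mult_matrix_inv)
  ultimately show ?thesis using cramer[of M "matrix_inv M *v z" z] by (simp add: divide_inverse)
qed

lemma smooth_on_matrix_inv_mult_vec:
  fixes F :: "'a::real_normed_vector \<Rightarrow> complex ^ 'n ^ 'n"
  assumes "smooth_on F S" "smooth_on g S" "\<And>x. x \<in> S \<Longrightarrow> invertible (F x)"
  shows "smooth_on (\<lambda>x. matrix_inv (F x) *v g x) S"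
proof -
  have "smooth_on (\<lambda>x. (if j = k then g x $ i else F x $ i $ j)) S" for i j k
    using assms by (cases "j = k") (auto intro!: smooth_on_vec_nth)
  then have *: "smooth_on (\<lambda>x. det (\<chi> i j. if j = k then g x $ i else F x $ i $ j)) S" for k
    by (intro smooth_on_det) simp
  have "smooth_on (\<lambda>x. (\<chi> k. det (\<chi> i j. if j = k then g x $ i else F x $ i $ j) *
      inverse (det (F x)))) S"
    using assms(3)
    by (intro smooth_on_vecI)
      (auto intro!: smooth_on_mult * smooth_on_inverse smooth_on_det smooth_on_vec_nth assms(1)
        simp: invertible_det_nz)
  then show ?thesis
    by (rule smooth_on_cong) (simp add: matrix_inv_mult_vec_cramer assms(3))
qed

text \<open>The derivative of a local extension restricts to \<open>S\<close>. Coordinate changes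
  and differentials are derivatives within subsets of half-spaces, so this is the form needed at
  boundary points.\<close>

lemma smooth_on_imp_differentiable_within:
  assumes "smooth_on f S" "x \<in> S"
  shows "f differentiable (at x within S)"
proof -
  obtain W g where W: "open W" "x \<in> W" "\<And>k. Ck_on k g W"
    "\<And>y. y \<in> S \<Longrightarrow> y \<in> W \<Longrightarrow> g y = f y" using assms unfolding smooth_on_def by (metis IntI)
  have "g differentiable (at x within S)"
    using W(2) W(3)[of 1] by (auto intro: differentiable_at_withinI)
  then obtain D where "(g has_derivative D) (at x within S)" by (auto simp: differentiable_def)
  moreover obtain e where e: "e > 0" "ball x e \<subseteq> W" using W(1,2) openE by blast
  moreover have "g y = f y" if "y \<in> S" "dist y x < e" for y
    using that e(2) W(4) by (metis dist_commute mem_ball subsetD)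
  ultimately have "(f has_derivative D) (at x within S)"
    using assms(2) by (metis has_derivative_transform_within)
  then show ?thesis by (auto simp: differentiable_def)
qed

section \<open>Fibres of the complexified tangent bundle\<close>

text \<open>\<open>frechet_derivative\<close> is known to be linear only where a derivative exists;
  smoothness of the transition maps supplies one.\<close>

lemma linear_coord_change:
  assumes "smooth_manifold_with_boundary X A" "c \<in> A" "d \<in> A" "p \<in> fst c \<inter> fst d"
  shows "linear (coord_change c d p)"
proof -
  have "(snd d \<circ> chart_inv c) differentiable (at (snd c p) within snd c ` (fst c \<inter> fst d))"
    using assms unfolding smooth_manifold_with_boundary_def
    by (intro smooth_on_imp_differentiable_within) blast+
  then show ?thesis unfolding coord_change_def
    using frechet_derivative_works has_derivative_linear by blast
qed

text \<open>One real combination serves both fibre operations: \<open>a = b = 1\<close> gives sums,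
  and the coefficients \<open>Re z\<close> and \<open>- Im z\<close> or \<open>Im z\<close> give the
  two components of \<open>ct_scale\<close>.\<close>

lemma tangent_space_combination:
  assumes "smooth_manifold_with_boundary X A" "v \<in> tangent_space A p" "w \<in> tangent_space A p"
  shows "(\<lambda>c. a *\<^sub>R v c + b *\<^sub>R w c) \<in> tangent_space A p"
  unfolding tangent_space_def mem_Collect_eq
proof (intro conjI ballI allI impI)
  fix c d assume c: "c \<in> A" "d \<in> A" "p \<in> fst c \<inter> fst d"
  note lin = linear_coord_change[OF assms(1) c]
  have "v d = coord_change c d p (v c)" "w d = coord_change c d p (w c)"
    using assms(2,3) c unfolding tangent_space_def by blast+
  then show "a *\<^sub>R v d + b *\<^sub>R w d = coord_change c d p (a *\<^sub>R v c + b *\<^sub>R w c)"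
    by (simp only: linear_add[OF lin] linear_scale[OF lin])
next
  fix c assume "\<not> (c \<in> A \<and> p \<in> fst c)"
  then have "v c = 0" "w c = 0" using assms(2,3) unfolding tangent_space_def by blast+
  then show "a *\<^sub>R v c + b *\<^sub>R w c = 0" by simp
qed

lemma ctangent_space_add:
  assumes "smooth_manifold_with_boundary X A" "V \<in> ctangent_space A p" "W \<in> ctangent_space A p"
  shows "ct_add V W \<in> ctangent_space A p"
  using assms(2,3) tangent_space_combination[OF assms(1), of _ p _ 1 1]
  by (simp add: ctangent_space_def ct_add_def mem_Times_iff)

lemma ctangent_space_scale:
  assumes "smooth_manifold_with_boundary X A" "V \<in> ctangent_space A p"
  shows "ct_scale z V \<in> ctangent_space A p"
  using assms(2) tangent_space_combination[OF assms(1), of "fst V" p "snd V" "Re z" "- Im z"]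
    tangent_space_combination[OF assms(1), of "snd V" p "fst V" "Re z" "Im z"]
  by (simp add: ctangent_space_def ct_scale_def mem_Times_iff)

text \<open>A tangent vector is determined by its coordinates in one chart. This links abstract
  fibre elements to the form in which \<open>trivialization\<close> states smoothness.\<close>

lemma tangent_space_eq_chart_tvec:
  assumes "v \<in> tangent_space A p" "c \<in> A" "p \<in> fst c"
  shows "v = chart_tvec A c p (v c)"
proof
  fix d
  show "v d = chart_tvec A c p (v c) d"
  proof (cases "d \<in> A \<and> p \<in> fst d")
    case True
    then have "v d = coord_change c d p (v c)" using assms unfolding tangent_space_def by blast
    then show ?thesis using True by (simp only: chart_tvec_def simp_thms if_True)
  next
    case False
    then have "v d = 0" using assms unfolding tangent_space_def by blast
    then show ?thesis using False by (simp only: chart_tvec_def if_False)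
  qed
qed

section \<open>Linear algebra on a single fibre\<close>

lemma trivialization_linear:
  assumes "trivialization X A \<phi>" "p \<in> topspace X"
  shows "bij_betw (\<phi> p) (ctangent_space A p) UNIV"
    and "V \<in> ctangent_space A p \<Longrightarrow> W \<in> ctangent_space A p \<Longrightarrow> \<phi> p (ct_add V W) = \<phi> p V + \<phi> p W"
    and "V \<in> ctangent_space A p \<Longrightarrow> \<phi> p (ct_scale z V) = z *s \<phi> p V"
  using assms unfolding trivialization_def by blast+

lemma trivialization_inv:
  assumes "trivialization X A \<phi>" "p \<in> topspace X"
  shows "inv_into (ctangent_space A p) (\<phi> p) z \<in> ctangent_space A p"
    and "\<phi> p (inv_into (ctangent_space A p) (\<phi> p) z) = z"
    and "V \<in> ctangent_space A p \<Longrightarrow> inv_into (ctangent_space A p) (\<phi> p) (\<phi> p V) = V"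
  using trivialization_linear(1)[OF assms]
  by (auto simp: bij_betw_def f_inv_into_f intro!: inv_into_into)

text \<open>The inverse of a linear bijection is linear, because preimages are unique and the fibre
  is closed under the operations. The map \<open>\<psi>\<close> is kept general to cover both
  another trivialization and \<open>cdifferential\<close>; linearity is what lets
  \<open>matrix\<close> represent the composite.\<close>

lemma linear_comp_trivialization_inv:
  assumes "smooth_manifold_with_boundary X A" "trivialization X A \<phi>" "p \<in> topspace X"
    and add: "\<And>V W. V \<in> ctangent_space A p \<Longrightarrow> W \<in> ctangent_space A p \<Longrightarrow>
      \<psi> (ct_add V W) = \<psi> V + \<psi> W"
    and scale: "\<And>z V. V \<in> ctangent_space A p \<Longrightarrow> \<psi> (ct_scale z V) = z *s \<psi> V"
  shows "Vector_Spaces.linear (*s) (*s) (\<lambda>z. \<psi> (inv_into (ctangent_space A p) (\<phi> p) z))"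
proof -
  let ?I = "inv_into (ctangent_space A p) (\<phi> p)"
  note inv = trivialization_inv[OF assms(2,3)] and lin = trivialization_linear[OF assms(2,3)]
  have "?I (x + y) = ct_add (?I x) (?I y)" for x y
    using inv(3)[OF ctangent_space_add[OF assms(1) inv(1)[of x] inv(1)[of y]]]
      lin(2)[OF inv(1)[of x] inv(1)[of y]] inv(2) by simp
  moreover have "?I (z *s x) = ct_scale z (?I x)" for z x
    using inv(3)[OF ctangent_space_scale[OF assms(1) inv(1)[of x]]]
      lin(3)[OF inv(1)[of x]] inv(2) by simp
  ultimately show ?thesis
    using add[OF inv(1) inv(1)] scale[OF inv(1)]
    by unfold_locales (simp_all add: vec.scale_right_distrib vec.scale_left_distrib)
qed

text \<open>The differential reads \<open>v\<close> in the one chart chosen by its definition. It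
  takes a derivative within the whole chart image, although \<open>g\<close> is controlled on
  \<open>U\<close> only. The chart is a homeomorphism, so the image of \<open>U\<close> is
  relatively open and both derivatives agree.\<close>

lemma linear_differential:
  fixes A :: "('a, 'n::finite) chart set" and g :: "'a \<Rightarrow> 'b::real_normed_vector"
  assumes "smooth_manifold_with_boundary X A" "openin X U" "smooth_on_manifold A U g" "p \<in> U"
  shows "\<exists>c D. linear D \<and> differential A g p = (\<lambda>v. D (v c))"
proof -
  define c where "c = (SOME c. c \<in> A \<and> p \<in> fst c)"
  have "p \<in> topspace X" using assms(2,4) openin_subset by blast
  then have "\<exists>c. c \<in> A \<and> p \<in> fst c"
    using assms(1) unfolding smooth_manifold_with_boundary_def by blast
  then have c: "c \<in> A" "p \<in> fst c" unfolding c_def by (metis (mono_tags, lifting) someI_ex)+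
  have "openin (subtopology X (fst c)) (fst c \<inter> U)"
    using assms(2) by (simp add: openin_subtopology_Int2)
  moreover have "homeomorphic_map (subtopology X (fst c)) (top_of_set (chart_img c)) (snd c)"
    using assms(1) c unfolding smooth_manifold_with_boundary_def is_chart_def by blast
  ultimately have "openin (top_of_set (chart_img c)) (snd c ` (fst c \<inter> U))"
    using homeomorphic_imp_open_map open_map_def by blast
  then obtain T where T: "open T" "snd c ` (fst c \<inter> U) = chart_img c \<inter> T"
    by (auto simp: openin_open)
  have "smooth_on (g \<circ> chart_inv c) (snd c ` (fst c \<inter> U))"
    using assms(3) c by (auto simp: smooth_on_manifold_def)
  moreover have "snd c p \<in> snd c ` (fst c \<inter> U)" using c assms(4) by blast
  ultimately have "(g \<circ> chart_inv c) differentiable (at (snd c p) within chart_img c \<inter> T)"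
    unfolding T(2)[symmetric] by (rule smooth_on_imp_differentiable_within)
  moreover have "snd c p \<in> T" using c assms(4) T by blast
  ultimately have "(g \<circ> chart_inv c) differentiable (at (snd c p) within chart_img c)"
    \<comment> \<open>Cutting down to the open set \<open>T\<close> around the point does not change
      the filter \<open>at _ within _\<close>.\<close>
    using at_within_nhd[OF _ T(1), of "snd c p" "chart_img c \<inter> T" "chart_img c"] by simp
  then have "linear (frechet_derivative (g \<circ> chart_inv c) (at (snd c p) within chart_img c))"
    using frechet_derivative_works has_derivative_linear by blast
  then show ?thesis
    by (intro exI[of _ c] exI conjI) (auto simp: differential_def c_def Let_def)
qed

text \<open>Valid for all pairs of coordinate families, in the fibre or not, since only their values
  at one chart enter.\<close>

lemma cdifferential_linear:
  assumes "smooth_manifold_with_boundary X A" "openin X U" "smooth_on_manifold A U f" "p \<in> U"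
  shows "cdifferential A f p (ct_add V W) = cdifferential A f p V + cdifferential A f p W"
    and "cdifferential A f p (ct_scale z V) = z *s cdifferential A f p V"
proof -
  obtain c D where D: "linear D" and eq: "differential A f p = (\<lambda>v. D (v c))"
    using linear_differential[OF assms] by blast
  show "cdifferential A f p (ct_add V W) = cdifferential A f p V + cdifferential A f p W"
    using D by (simp add: cdifferential_def eq ct_add_def linear_add vec.scale_right_distrib)
  show "cdifferential A f p (ct_scale z V) = z *s cdifferential A f p V"
    using D by (simp add: cdifferential_def eq ct_scale_def linear_add linear_diff linear_scale
        vec_eq_iff complex_eq_iff algebra_simps)
qed

section \<open>Trivializations and maps into the general linear group\<close>

text \<open>Column \<open>j\<close> of the matrix is the image of \<open>axis j 1\<close>. In a
  chart it is the local form \<open>F\<close> of \<open>\<psi>\<close> applied to the local form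
  \<open>G\<close> of the inverse of \<open>\<phi>\<close>, a composite of smooth maps.\<close>

lemma smooth_on_manifold_transition:
  assumes "smooth_manifold_with_boundary X A" "trivialization X A \<phi>" "trivialization X A \<psi>"
  shows "smooth_on_manifold A (topspace X)
    (\<lambda>p. matrix (\<lambda>z. \<psi> p (inv_into (ctangent_space A p) (\<phi> p) z)))"
  unfolding smooth_on_manifold_def
proof (intro ballI smooth_on_vecI)
  fix c i j assume c: "c \<in> A"
  have sub: "fst c \<subseteq> topspace X"
    using assms(1) c unfolding smooth_manifold_with_boundary_def by blast
  define F where "F = (\<lambda>(x, u, w). let p = chart_inv c x in
    \<psi> p (chart_tvec A c p u, chart_tvec A c p w))"
  define G where "G = (\<lambda>(x, z). let p = chart_inv c x;
    V = inv_into (ctangent_space A p) (\<phi> p) z in (fst V c, snd V c))"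
  have F: "smooth_on F (chart_img c \<times> UNIV \<times> UNIV)"
    using assms(3) c by (simp add: trivialization_def F_def)
  have G: "smooth_on G (chart_img c \<times> UNIV)"
    using assms(2) c by (simp add: trivialization_def G_def)
  have "smooth_on (\<lambda>x. G (x, axis j 1)) (chart_img c)"
    by (rule smooth_on_compose[OF G smooth_on_Pair[OF smooth_on_ident smooth_on_const]]) simp
  then have "smooth_on (\<lambda>x. F (x, G (x, axis j 1))) (chart_img c)"
    by (intro smooth_on_compose[OF F] smooth_on_Pair smooth_on_ident) (auto simp: mem_Times_iff)
  then have "smooth_on (\<lambda>x. F (x, G (x, axis j 1)) $ i) (chart_img c)"
    by (rule smooth_on_vec_nth)
  moreover have "F (x, G (x, axis j 1)) $ i =
    ((\<lambda>p. matrix (\<lambda>z. \<psi> p (inv_into (ctangent_space A p) (\<phi> p) z))) \<circ> chart_inv c) x $ i $ j"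
    if x: "x \<in> chart_img c" for x
  proof -
    define p where "p = chart_inv c x"
    have p: "p \<in> fst c" unfolding p_def by (rule inv_into_into[OF x])
    define V where "V = inv_into (ctangent_space A p) (\<phi> p) (axis j 1)"
    have "V \<in> ctangent_space A p"
      unfolding V_def using trivialization_inv(1)[OF assms(2)] p sub by blast
    \<comment> \<open>\<open>G\<close> returns only the coordinates of \<open>V\<close> and
      \<open>F\<close> rebuilds a vector from them; the result is \<open>V\<close> itself.\<close>
    then have "(chart_tvec A c p (fst V c), chart_tvec A c p (snd V c)) = V"
      using tangent_space_eq_chart_tvec[OF _ c p] by (cases V) (auto simp: ctangent_space_def)
    then show ?thesis
      by (simp add: F_def G_def Let_def p_def[symmetric] V_def[symmetric] matrix_def)
  qed
  ultimately have "smooth_on (\<lambda>x. ((\<lambda>p. matrix (\<lambda>z. \<psi> p (inv_into (ctangent_space A p) (\<phi> p) z)))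
      \<circ> chart_inv c) x $ i $ j) (chart_img c)"
    by (rule smooth_on_cong)
  then show "smooth_on (\<lambda>x. ((\<lambda>p. matrix (\<lambda>z. \<psi> p (inv_into (ctangent_space A p) (\<phi> p) z)))
      \<circ> chart_inv c) x $ i $ j) (snd c ` (fst c \<inter> topspace X))"
    unfolding Int_absorb2[OF sub] .
qed

text \<open>The composite is linear and injective, and an injective square matrix is
  invertible.\<close>

lemma invertible_transition:
  assumes "smooth_manifold_with_boundary X A" "trivialization X A \<phi>" "trivialization X A \<psi>"
    and "p \<in> topspace X"
  shows "invertible (matrix (\<lambda>z. \<psi> p (inv_into (ctangent_space A p) (\<phi> p) z)))"
proof -
  let ?g = "\<lambda>z. \<psi> p (inv_into (ctangent_space A p) (\<phi> p) z)"
  have "Vector_Spaces.linear (*s) (*s) ?g"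
    using trivialization_linear[OF assms(3,4)]
    by (intro linear_comp_trivialization_inv[OF assms(1,2,4)]) auto
  then have "(*v) (matrix ?g) = ?g" by (simp add: matrix_works fun_eq_iff)
  moreover have "inj ?g"
    by (rule injI) (metis trivialization_inv[OF assms(2,4)] trivialization_inv[OF assms(3,4)])
  ultimately show ?thesis
    by (metis invertible_left_inverse matrix_left_invertible_injective)
qed

lemma trivialization_matrix_mult:
  fixes A :: "('a, 'n::finite) chart set" and N :: "'a \<Rightarrow> complex ^ 'n ^ 'n"
  assumes "smooth_manifold_with_boundary X A" "trivialization X A \<phi>"
    and N: "smooth_on_manifold A (topspace X) N" "\<And>p. p \<in> topspace X \<Longrightarrow> invertible (N p)"
  shows "trivialization X A (\<lambda>p V. N p *v \<phi> p V)"
  unfolding trivialization_def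
proof (intro conjI ballI allI)
  note lin = trivialization_linear[OF assms(2)] and inv = trivialization_inv[OF assms(2)]
  have NN: "N p *v (matrix_inv (N p) *v z) = z" "matrix_inv (N p) *v (N p *v z) = z"
    if "p \<in> topspace X" for p z
    using N(2)[OF that] by (simp_all add: matrix_vector_mul_assoc matrix_mult_matrix_inv)
  have bij: "bij_betw (\<lambda>V. N p *v \<phi> p V) (ctangent_space A p) UNIV" if "p \<in> topspace X" for p
  proof -
    have "bij ((*v) (N p))" using NN[OF that] by (intro o_bij[of "(*v) (matrix_inv (N p))"]) auto
    then show ?thesis using bij_betw_trans[OF lin(1)[OF that]] by (auto simp: o_def)
  qed
  then show "p \<in> topspace X \<Longrightarrow> bij_betw (\<lambda>V. N p *v \<phi> p V) (ctangent_space A p) UNIV" for p .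
  show "p \<in> topspace X \<Longrightarrow> V \<in> ctangent_space A p \<Longrightarrow> W \<in> ctangent_space A p \<Longrightarrow>
      N p *v \<phi> p (ct_add V W) = N p *v \<phi> p V + N p *v \<phi> p W" for p V W
    by (simp add: lin(2) matrix_vector_right_distrib)
  show "p \<in> topspace X \<Longrightarrow> V \<in> ctangent_space A p \<Longrightarrow>
      N p *v \<phi> p (ct_scale z V) = z *s (N p *v \<phi> p V)" for p z V
    by (simp add: lin(3) vector_scalar_commute)
  fix c assume c: "c \<in> A"
  have sub: "fst c \<subseteq> topspace X"
    using assms(1) c unfolding smooth_manifold_with_boundary_def by blast
  have "smooth_on (\<lambda>x. N (chart_inv c x)) (snd c ` (fst c \<inter> topspace X))"
    using N(1) c unfolding smooth_on_manifold_def o_def by blast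
  then have Nc: "smooth_on (\<lambda>x. N (chart_inv c x)) (chart_img c)"
    unfolding Int_absorb2[OF sub] .
  \<comment> \<open>\<open>T\<close> has a generic type because the second factor is a pair of real
    vectors for the trivialization and a complex vector for its inverse.\<close>
  have Nfst: "smooth_on (\<lambda>y. N (chart_inv c (fst y))) (chart_img c \<times> T)"
    for T :: "'b::real_normed_vector set"
    by (rule smooth_on_compose[OF Nc smooth_on_linear[OF bounded_linear_fst]]) auto
  have "smooth_on (\<lambda>y. N (chart_inv c (fst y)) *v
      (case y of (x, u, w) \<Rightarrow> let p = chart_inv c x in
        \<phi> p (chart_tvec A c p u, chart_tvec A c p w))) (chart_img c \<times> UNIV \<times> UNIV)"
    using assms(2) c by (intro smooth_on_matrix_vector_mult Nfst) (simp add: trivialization_def)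
  then show "smooth_on (\<lambda>(x, u, w). let p = chart_inv c x in
      N p *v \<phi> p (chart_tvec A c p u, chart_tvec A c p w)) (chart_img c \<times> UNIV \<times> UNIV)"
    by (simp add: case_prod_beta' Let_def)
  define G where "G = (\<lambda>(x, z). let p = chart_inv c x;
    V = inv_into (ctangent_space A p) (\<phi> p) z in (fst V c, snd V c))"
  have G: "smooth_on G (chart_img c \<times> UNIV)"
    using assms(2) c by (simp add: trivialization_def G_def)
  have chart: "chart_inv c x \<in> topspace X" if "x \<in> chart_img c" for x
    using inv_into_into[OF that] sub by blast
  have "smooth_on (\<lambda>y. matrix_inv (N (chart_inv c (fst y))) *v snd y) (chart_img c \<times> UNIV)"
    using N(2) chart
    by (intro smooth_on_matrix_inv_mult_vec Nfst smooth_on_linear[OF bounded_linear_snd]) auto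
  then have "smooth_on (\<lambda>y. G (fst y, matrix_inv (N (chart_inv c (fst y))) *v snd y))
      (chart_img c \<times> UNIV)"
    by (intro smooth_on_compose[OF G] smooth_on_Pair smooth_on_linear[OF bounded_linear_fst]) auto
  \<comment> \<open>The new inverse is the old one precomposed with the inverse matrix, so its local
    form is \<open>G\<close> with a changed second argument.\<close>
  moreover have "inv_into (ctangent_space A p) (\<lambda>V. N p *v \<phi> p V) z =
      inv_into (ctangent_space A p) (\<phi> p) (matrix_inv (N p) *v z)" if "p \<in> topspace X" for p z
    using bij[OF that] inv(1,2)[OF that] NN[OF that]
    by (intro inv_into_f_eq) (auto simp: bij_betw_def)
  ultimately show "smooth_on (\<lambda>(x, z). let p = chart_inv c x;
      V = inv_into (ctangent_space A p) (\<lambda>V. N p *v \<phi> p V) z in (fst V c, snd V c))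
      (chart_img c \<times> UNIV)"
    using chart by (elim smooth_on_cong) (auto simp: G_def Let_def)
qed

theorem lemma4p11:
  fixes X :: "'a topology" and A :: "('a, 'n::finite) chart set"
    and ori :: "('a, 'n) chart \<Rightarrow> 'a \<Rightarrow> real"
    and S U :: "'a set" and f :: "'a \<Rightarrow> complex ^ 'n"
    and \<phi>\<^sub>0 :: "'a \<Rightarrow> ('a, 'n) ctvec \<Rightarrow> complex ^ 'n"
    and M :: "'a \<Rightarrow> complex ^ 'n ^ 'n"
  assumes "initial_data X A ori S U f"
    and "trivialization X A \<phi>\<^sub>0"
    and "\<forall>p\<in>U. M p = comparison_map A f \<phi>\<^sub>0 p"
  shows "(\<exists>\<phi>. trivialization X A \<phi> \<and> compatible X A S U f \<phi>) \<longleftrightarrow> extends_to_GL X A S U M"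
proof -
  have man: "smooth_manifold_with_boundary X A" and U: "openin X U"
    and f: "smooth_on_manifold A U f"
    using assms(1) by (auto simp: initial_data_def exact_lagrangian_immersion_def)
  have UX: "U \<subseteq> topspace X" using U openin_subset by blast
  show ?thesis
  proof
    assume "\<exists>\<phi>. trivialization X A \<phi> \<and> compatible X A S U f \<phi>"
    then obtain \<phi> V where \<phi>: "trivialization X A \<phi>"
      and V: "openin X V" "S \<subseteq> V" "V \<subseteq> U"
        "\<And>p v. p \<in> V \<Longrightarrow> v \<in> ctangent_space A p \<Longrightarrow> \<phi> p v = cdifferential A f p v"
      unfolding compatible_def by blast
    define Mhat where
      "Mhat p = matrix (\<lambda>z. \<phi> p (inv_into (ctangent_space A p) (\<phi>\<^sub>0 p) z))" for p
    have "Mhat p = M p" if "p \<in> V" for p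
    proof -
      have "p \<in> topspace X" using that V(3) UX by blast
      then show ?thesis
        \<comment> \<open>Compatibility speaks about fibre elements only, and the inverse of
          \<open>\<phi>\<^sub>0\<close> lands in the fibre, so both matrices come from the same
          function.\<close>
        using that V(3) assms(3) V(4)[OF that trivialization_inv(1)[OF assms(2)]]
        by (auto simp: Mhat_def comparison_map_def)
    qed
    moreover have "smooth_on_manifold A (topspace X) Mhat"
      unfolding Mhat_def using smooth_on_manifold_transition[OF man assms(2) \<phi>] .
    moreover have "\<forall>p\<in>topspace X. invertible (Mhat p)"
      unfolding Mhat_def using invertible_transition[OF man assms(2) \<phi>] by blast
    ultimately show "extends_to_GL X A S U M"
      unfolding extends_to_GL_def using V by blast
  next
    assume "extends_to_GL X A S U M"
    then obtain Mhat V where Mhat: "smooth_on_manifold A (topspace X) Mhat"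
        "\<And>p. p \<in> topspace X \<Longrightarrow> invertible (Mhat p)"
      and V: "openin X V" "S \<subseteq> V" "V \<subseteq> U" "\<And>p. p \<in> V \<Longrightarrow> Mhat p = M p"
      unfolding extends_to_GL_def by blast
    have "Mhat p *v \<phi>\<^sub>0 p v = cdifferential A f p v"
      if p: "p \<in> V" and v: "v \<in> ctangent_space A p" for p v
    proof -
      let ?g = "\<lambda>z. cdifferential A f p (inv_into (ctangent_space A p) (\<phi>\<^sub>0 p) z)"
      have pU: "p \<in> U" and pX: "p \<in> topspace X" using p V(3) UX by blast+
      have "Vector_Spaces.linear (*s) (*s) ?g"
        using cdifferential_linear[OF man U f pU]
        by (intro linear_comp_trivialization_inv[OF man assms(2) pX]) auto
      \<comment> \<open>\<open>M p\<close> is by definition the matrix of \<open>?g\<close>;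
        linearity turns its product back into \<open>?g\<close>, after which
        \<open>\<phi>\<^sub>0\<close> cancels against its inverse.\<close>
      then have "matrix ?g *v \<phi>\<^sub>0 p v = ?g (\<phi>\<^sub>0 p v)" by (rule matrix_works)
      then show ?thesis
        using V(4)[OF p] assms(3) pU trivialization_inv(3)[OF assms(2) pX v]
        by (simp add: comparison_map_def)
    qed
    then have "compatible X A S U f (\<lambda>p v. Mhat p *v \<phi>\<^sub>0 p v)"
      unfolding compatible_def using V by blast
    then show "\<exists>\<phi>. trivialization X A \<phi> \<and> compatible X A S U f \<phi>"
      using trivialization_matrix_mult[OF man assms(2) Mhat] by blast
  qed
qed

end
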